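(* Let $\Gamma=\left(M_{(1)1}^{(i)},N_{(1)j}^{(i)}\right)$ be a nonlinear connection on $E=J^1(\mathbb{R},M)$ and let $\nabla$ be a $\Gamma$-linear connection on $E$ with adapted coefficients $$\nabla\Gamma=\left(\bar G_{11}^1,\;G_{i1}^k,\;G_{(1)(j)1}^{(i)(1)},\;\bar L_{1j}^1,\;L_{ij}^k,\;L_{(1)(j)k}^{(i)(1)},\;\bar C_{1(k)}^{1(1)},\;C_{i(k)}^{j(1)},\;C_{(1)(j)(k)}^{(i)(1)(1)}\right).$$ The deflection d-tensors of $\nabla$ have the expressions $$\bar D_{(1)1}^{(i)}=-M_{(1)1}^{(i)}+G_{(1)(r)1}^{(i)(1)}y_1^r,\qquad D_{(1)j}^{(i)}=-N_{(1)j}^{(i)}+L_{(1)(r)j}^{(i)(1)}y_1^r,\qquad d_{(1)(j)}^{(i)(1)}=\delta_j^i+C_{(1)(r)(j)}^{(i)(1)(1)}y_1^r.$$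
   Context: $M$ is a smooth $n$-dimensional manifold with local coordinates $(x^i)_{i=\overline{1,n}}$, $\mathbb{R}$ is the time manifold with coordinate $t$, and $E=J^1(\mathbb{R},M)\to\mathbb{R}\times M$ is the 1-jet vector bundle, with local coordinates $(t,x^i,y_1^i)$ transforming by $$\tilde t=\tilde t(t),\quad \tilde x^i=\tilde x^i(x^j),\quad \tilde y_1^i=\frac{\partial\tilde x^i}{\partial x^j}\frac{dt}{d\tilde t}\,y_1^j .$$ Latin indices run over $1,\dots,n$ and repeated Latin indices are summed; the index $1$ refers to the single time direction. A nonlinear connection $\Gamma=\left(M_{(1)1}^{(i)},N_{(1)j}^{(i)}\right)$ on $E$ is a family of local functions on the charts of $E$ transforming by $$\tilde M_{(1)1}^{(k)}=M_{(1)1}^{(j)}\left(\frac{dt}{d\tilde t}\right)^2\frac{\partial\tilde x^k}{\partial x^j}-\frac{dt}{d\tilde t}\frac{\partial\tilde y_1^k}{\partial t},\qquad \tilde N_{(1)l}^{(k)}=N_{(1)i}^{(j)}\frac{dt}{d\tilde t}\frac{\partial x^i}{\partial\tilde x^l}\frac{\partial\tilde x^k}{\partial x^j}-\frac{\partial x^i}{\partial\tilde x^l}\frac{\partial\tilde y_1^k}{\partial x^i}.$$ The adapted basis of vector fields is $$\frac{\delta}{\delta t}=\frac{\partial}{\partial t}-M_{(1)1}^{(j)}\frac{\partial}{\partial y_1^j},\quad \frac{\delta}{\delta x^i}=\frac{\partial}{\partial x^i}-N_{(1)i}^{(j)}\frac{\partial}{\partial y_1^j},\quad \frac{\partial}{\partial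 y_1^i}.$$ $h_{\mathbb{R}}$, $h_M$, $v$ denote the projections of $\mathcal{X}(E)$ onto the summands locally spanned respectively by $\frac{\delta}{\delta t}$, by the $\frac{\delta}{\delta x^i}$, by the $\frac{\partial}{\partial y_1^i}$. A $\Gamma$-linear connection on $E$ is a linear connection $\nabla$ on $E$ with $\nabla h_{\mathbb{R}}=0$, $\nabla h_M=0$, $\nabla v=0$, i.e. $\nabla_X(hY)=h(\nabla_XY)$ for $h\in\{h_{\mathbb{R}},h_M,v\}$. Its adapted coefficients in a chart are defined by $$\nabla_{\frac{\delta}{\delta t}}\frac{\delta}{\delta t}=\bar G_{11}^1\frac{\delta}{\delta t},\quad \nabla_{\frac{\delta}{\delta t}}\frac{\delta}{\delta x^i}=G_{i1}^k\frac{\delta}{\delta x^k},\quad \nabla_{\frac{\delta}{\delta t}}\frac{\partial}{\partial y_1^i}=G_{(1)(i)1}^{(k)(1)}\frac{\partial}{\partial y_1^k},$$ $$\nabla_{\frac{\delta}{\delta x^j}}\frac{\delta}{\delta t}=\bar L_{1j}^1\frac{\delta}{\delta t},\quad \nabla_{\frac{\delta}{\delta x^j}}\frac{\delta}{\delta x^i}=L_{ij}^k\frac{\delta}{\delta x^k},\quad \nabla_{\frac{\delta}{\delta x^j}}\frac{\partial}{\partial y_1^i}=L_{(1)(i)j}^{(k)(1)}\frac{\partial}{\partial y_1^k},$$ $$\nabla_{\frac{\partial}{\partial y_1^j}}\frac{\delta}{\delta t}=\bar C_{1(j)}^{1(1)}\frac{\delta}{\delta t},\quad \nabla_{\frac{\partial}{\partial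 y_1^j}}\frac{\delta}{\delta x^i}=C_{i(j)}^{k(1)}\frac{\delta}{\delta x^k},\quad \nabla_{\frac{\partial}{\partial y_1^j}}\frac{\partial}{\partial y_1^i}=C_{(1)(i)(j)}^{(k)(1)(1)}\frac{\partial}{\partial y_1^k}.$$ For a vertical d-vector field with components $Y_{(1)}^{(i)}$ the covariant derivatives are $$Y_{(1)/1}^{(i)}=\frac{\delta Y_{(1)}^{(i)}}{\delta t}+Y_{(1)}^{(r)}G_{(1)(r)1}^{(i)(1)},\quad Y_{(1)|p}^{(i)}=\frac{\delta Y_{(1)}^{(i)}}{\delta x^p}+Y_{(1)}^{(r)}L_{(1)(r)p}^{(i)(1)},\quad Y_{(1)}^{(i)}|_{(p)}^{(1)}=\frac{\partial Y_{(1)}^{(i)}}{\partial y_1^p}+Y_{(1)}^{(r)}C_{(1)(r)(p)}^{(i)(1)(1)}.$$ The canonical Liouville d-tensor field is $\mathbf{C}=\mathbf{C}_{(1)}^{(i)}\frac{\partial}{\partial y_1^i}$ with $\mathbf{C}_{(1)}^{(i)}=y_1^i$. The deflection d-tensors of $\nabla$ are defined by $$\bar D_{(1)1}^{(i)}=\mathbf{C}_{(1)/1}^{(i)},\quad D_{(1)j}^{(i)}=\mathbf{C}_{(1)|j}^{(i)},\quad d_{(1)(j)}^{(i)(1)}=\mathbf{C}_{(1)}^{(i)}|_{(j)}^{(1)}.$$ *)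

theory Defs
  imports "HOL-Analysis.Analysis"
begin

section \<open>Smooth functions and smooth manifolds\<close>

primrec C_diff_on :: "nat \<Rightarrow> 'a::real_normed_vector set \<Rightarrow> ('a \<Rightarrow> 'b::real_normed_vector) \<Rightarrow> bool" where
  "C_diff_on 0 S f \<longleftrightarrow> continuous_on S f"
| "C_diff_on (Suc k) S f \<longleftrightarrow> (\<forall>x\<in>S. f differentiable (at x)) \<and>
     (\<forall>v. C_diff_on k S (\<lambda>x. frechet_derivative f (at x) v))"

text \<open>Used for open \<open>S\<close> in a Euclidean space only, where it is the usual \<open>C\<^sup>\<infinity>\<close>.\<close>

definition smooth_on :: "'a::real_normed_vector set \<Rightarrow> ('a \<Rightarrow> 'b::real_normed_vector) \<Rightarrow> bool" where
  "smooth_on S f \<longleftrightarrow> (\<forall>k. C_diff_on k S f)"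

text \<open>A chart is a domain together with a coordinate map. The values of the coordinate map outside
  the domain are irrelevant.\<close>

type_synonym ('a, 'v) chart = "'a set \<times> ('a \<Rightarrow> 'v)"

abbreviation cdom :: "('a, 'v) chart \<Rightarrow> 'a set" where "cdom \<equiv> fst"
abbreviation cmap :: "('a, 'v) chart \<Rightarrow> 'a \<Rightarrow> 'v" where "cmap \<equiv> snd"

definition cinv :: "('a, 'v) chart \<Rightarrow> 'v \<Rightarrow> 'a" where
  "cinv c = inv_into (cdom c) (cmap c)"

definition is_chart :: "'a topology \<Rightarrow> ('a, 'v::euclidean_space) chart \<Rightarrow> bool" where
  "is_chart X c \<longleftrightarrow> openin X (cdom c) \<and> open (cmap c ` cdom c) \<and>
     homeomorphic_map (subtopology X (cdom c)) (top_of_set (cmap c ` cdom c)) (cmap c)"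

definition compatible :: "('a, 'v::euclidean_space) chart \<Rightarrow> ('a, 'v) chart \<Rightarrow> bool" where
  "compatible c d \<longleftrightarrow>
     smooth_on (cmap c ` (cdom c \<inter> cdom d)) (cmap d \<circ> cinv c) \<and>
     smooth_on (cmap d ` (cdom c \<inter> cdom d)) (cmap c \<circ> cinv d)"

definition smooth_manifold :: "'a topology \<Rightarrow> ('a, 'v::euclidean_space) chart set \<Rightarrow> bool" where
  "smooth_manifold X A \<longleftrightarrow> Hausdorff_space X \<and> second_countable X \<and>
     (\<forall>c\<in>A. is_chart X c) \<and> (\<Union>c\<in>A. cdom c) = topspace X \<and>
     (\<forall>c\<in>A. \<forall>d\<in>A. compatible c d) \<and>
     (\<forall>c. is_chart X c \<and> (\<forall>d\<in>A. compatible c d) \<longrightarrow> c \<in> A)"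

section \<open>Vector fields and linear connections, relative to an atlas\<close>

definition carrier_of :: "('a, 'v) chart set \<Rightarrow> 'a set" where
  "carrier_of B = (\<Union>c\<in>B. cdom c)"

definition atlas_open :: "('a, 'v::euclidean_space) chart set \<Rightarrow> 'a set \<Rightarrow> bool" where
  "atlas_open B S \<longleftrightarrow> S \<subseteq> carrier_of B \<and> (\<forall>c\<in>B. open (cmap c ` (S \<inter> cdom c)))"

definition smooth_at :: "('a, 'v::euclidean_space) chart set \<Rightarrow> ('a \<Rightarrow> real) \<Rightarrow> 'a \<Rightarrow> bool" where
  "smooth_at B f p \<longleftrightarrow> (\<exists>c\<in>B. p \<in> cdom c \<and>
     (\<exists>W. open W \<and> cmap c p \<in> W \<and> W \<subseteq> cmap c ` cdom c \<and> smooth_on W (f \<circ> cinv c)))"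

text \<open>Tangent vectors at \<open>p\<close> are derivations of the functions that are smooth near \<open>p\<close>; the value
  on all other functions is fixed to be \<open>0\<close>, so that equality of tangent vectors is equality
  of HOL functions. Locality follows from the Leibniz rule.\<close>

type_synonym 'a tvec = "('a \<Rightarrow> real) \<Rightarrow> real"
type_synonym 'a vfield = "'a \<Rightarrow> 'a tvec"

definition tangent_space :: "('a, 'v::euclidean_space) chart set \<Rightarrow> 'a \<Rightarrow> 'a tvec set" where
  "tangent_space B p = {D.
     (\<forall>f. \<not> smooth_at B f p \<longrightarrow> D f = 0) \<and>
     (\<forall>f g a b. smooth_at B f p \<and> smooth_at B g p \<longrightarrow>
        D (\<lambda>q. a * f q + b * g q) = a * D f + b * D g) \<and>
     (\<forall>f g. smooth_at B f p \<and> smooth_at B g p \<longrightarrow>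
        D (\<lambda>q. f q * g q) = D f * g p + f p * D g)}"

definition vector_field :: "('a, 'v::euclidean_space) chart set \<Rightarrow> 'a vfield \<Rightarrow> bool" where
  "vector_field B X \<longleftrightarrow>
     (\<forall>p\<in>carrier_of B. X p \<in> tangent_space B p) \<and>
     (\<forall>p. p \<notin> carrier_of B \<longrightarrow> X p = (\<lambda>f. 0)) \<and>
     (\<forall>f p. smooth_at B f p \<longrightarrow> smooth_at B (\<lambda>q. X q f) p)"

definition vf_add :: "'a vfield \<Rightarrow> 'a vfield \<Rightarrow> 'a vfield" where
  "vf_add X Y = (\<lambda>p f. X p f + Y p f)"

definition vf_mult :: "('a \<Rightarrow> real) \<Rightarrow> 'a vfield \<Rightarrow> 'a vfield" where
  "vf_mult g X = (\<lambda>p f. g p * X p f)"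

definition linear_connection ::
  "('a, 'v::euclidean_space) chart set \<Rightarrow> ('a vfield \<Rightarrow> 'a vfield \<Rightarrow> 'a vfield) \<Rightarrow> bool" where
  "linear_connection B nabla \<longleftrightarrow>
     (\<forall>X Y. vector_field B X \<and> vector_field B Y \<longrightarrow> vector_field B (nabla X Y)) \<and>
     (\<forall>X Y Z. vector_field B X \<and> vector_field B Y \<and> vector_field B Z \<longrightarrow>
        nabla (vf_add X Y) Z = vf_add (nabla X Z) (nabla Y Z) \<and>
        nabla X (vf_add Y Z) = vf_add (nabla X Y) (nabla X Z)) \<and>
     (\<forall>X Y g. vector_field B X \<and> vector_field B Y \<and> (\<forall>p\<in>carrier_of B. smooth_at B g p) \<longrightarrow>
        nabla (vf_mult g X) Y = vf_mult g (nabla X Y) \<and>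
        nabla X (vf_mult g Y) = vf_add (vf_mult (\<lambda>p. X p g) Y) (vf_mult g (nabla X Y)))"

text \<open>A connection acts on fields defined only near \<open>p\<close> (such as a local frame) through global
  fields with the same germ at \<open>p\<close>; they exist by bump functions, and the value at \<open>p\<close> does not
  depend on which ones are taken.\<close>

definition agree_near ::
  "('a, 'v::euclidean_space) chart set \<Rightarrow> 'a \<Rightarrow> 'a vfield \<Rightarrow> 'a vfield \<Rightarrow> bool" where
  "agree_near B p X Y \<longleftrightarrow> (\<exists>S. atlas_open B S \<and> p \<in> S \<and> (\<forall>q\<in>S. X q = Y q))"

definition germ_ext :: "('a, 'v::euclidean_space) chart set \<Rightarrow> 'a \<Rightarrow> 'a vfield \<Rightarrow> 'a vfield" where
  "germ_ext B p X = (SOME X'. vector_field B X' \<and> agree_near B p X' X)"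

definition local_nabla :: "('a, 'v::euclidean_space) chart set \<Rightarrow>
    ('a vfield \<Rightarrow> 'a vfield \<Rightarrow> 'a vfield) \<Rightarrow> 'a vfield \<Rightarrow> 'a vfield \<Rightarrow> 'a vfield" where
  "local_nabla B nabla X Y p = nabla (germ_ext B p X) (germ_ext B p Y) p"

text \<open>The derivative in the coordinate direction \<open>v\<close> of the chart \<open>c\<close>, as a vector field
  on the domain of \<open>c\<close>.\<close>

definition coord_field ::
  "('a, 'v::euclidean_space) chart set \<Rightarrow> ('a, 'v) chart \<Rightarrow> 'v \<Rightarrow> 'a vfield" where
  "coord_field B c v p = (\<lambda>f. if smooth_at B f p
     then frechet_derivative (f \<circ> cinv c) (at (cmap c p)) v else 0)"

section \<open>The jet bundle \<open>J\<^sup>1(\<real>, M)\<close>\<close>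

text \<open>The maximal atlas of the standard smooth structure on the real line.\<close>

definition time_atlas :: "(real, real) chart set" where
  "time_atlas = {c. is_chart euclidean c \<and> compatible c (UNIV, id)}"

definition smooth_curve_at ::
  "('m, real ^ 'n::finite) chart set \<Rightarrow> (real \<Rightarrow> 'm) \<Rightarrow> real \<Rightarrow> bool" where
  "smooth_curve_at A \<gamma> t \<longleftrightarrow> (\<exists>c\<in>A. \<exists>J. open J \<and> t \<in> J \<and> \<gamma> ` J \<subseteq> cdom c \<and>
     smooth_on J (cmap c \<circ> \<gamma>))"

text \<open>A 1-jet is an equivalence class of pairs of a time \<open>t\<close> and a curve that is smooth
  near \<open>t\<close>, under contact of first order at \<open>t\<close>.\<close>

type_synonym 'm jet = "(real \<times> (real \<Rightarrow> 'm)) set"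

definition jet_of ::
  "('m, real ^ 'n::finite) chart set \<Rightarrow> real \<Rightarrow> (real \<Rightarrow> 'm) \<Rightarrow> 'm jet" where
  "jet_of A t \<gamma> = {(s, \<eta>). s = t \<and> smooth_curve_at A \<eta> t \<and> \<eta> t = \<gamma> t \<and>
     (\<forall>c\<in>A. \<gamma> t \<in> cdom c \<longrightarrow>
        vector_derivative (cmap c \<circ> \<eta>) (at t) = vector_derivative (cmap c \<circ> \<gamma>) (at t))}"

definition J1 :: "('m, real ^ 'n::finite) chart set \<Rightarrow> 'm jet set" where
  "J1 A = {jet_of A t \<gamma> | t \<gamma>. smooth_curve_at A \<gamma> t}"

definition jet_time :: "'m jet \<Rightarrow> real" where
  "jet_time z = fst (SOME r. r \<in> z)"

definition jet_curve :: "'m jet \<Rightarrow> real \<Rightarrow> 'm" where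
  "jet_curve z = snd (SOME r. r \<in> z)"

definition jet_point :: "'m jet \<Rightarrow> 'm" where
  "jet_point z = jet_curve z (jet_time z)"

text \<open>The charts of \<open>E = J\<^sup>1(\<real>, M)\<close> are induced by a chart of the time line and
  a chart of \<open>M\<close>.\<close>

type_synonym ('m, 'n) jet_index = "(real, real) chart \<times> ('m, real ^ 'n) chart"

definition jet_indices :: "('m, real ^ 'n::finite) chart set \<Rightarrow> ('m, 'n) jet_index set" where
  "jet_indices A = time_atlas \<times> A"

definition jet_dom ::
  "('m, real ^ 'n::finite) chart set \<Rightarrow> ('m, 'n) jet_index \<Rightarrow> 'm jet set" where
  "jet_dom A k = {z \<in> J1 A. jet_time z \<in> cdom (fst k) \<and> jet_point z \<in> cdom (snd k)}"

definition t_coord :: "('m, 'n::finite) jet_index \<Rightarrow> 'm jet \<Rightarrow> real" where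
  "t_coord k z = cmap (fst k) (jet_time z)"

definition x_coord :: "('m, 'n::finite) jet_index \<Rightarrow> 'n \<Rightarrow> 'm jet \<Rightarrow> real" where
  "x_coord k i z = cmap (snd k) (jet_point z) $ i"

text \<open>The velocity is taken with respect to the time coordinate of the chart.\<close>

definition y_coord :: "('m, 'n::finite) jet_index \<Rightarrow> 'n \<Rightarrow> 'm jet \<Rightarrow> real" where
  "y_coord k i z =
     vector_derivative (cmap (snd k) \<circ> jet_curve z \<circ> cinv (fst k)) (at (t_coord k z)) $ i"

definition jet_chart :: "('m, real ^ 'n::finite) chart set \<Rightarrow> ('m, 'n) jet_index \<Rightarrow>
    ('m jet, real \<times> (real ^ 'n) \<times> (real ^ 'n)) chart" where
  "jet_chart A k =
     (jet_dom A k, \<lambda>z. (t_coord k z, (\<chi> i. x_coord k i z), (\<chi> i. y_coord k i z)))"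

definition jet_atlas :: "('m, real ^ 'n::finite) chart set \<Rightarrow>
    ('m jet, real \<times> (real ^ 'n) \<times> (real ^ 'n)) chart set" where
  "jet_atlas A = jet_chart A ` jet_indices A"

definition d_t ::
  "('m, real ^ 'n::finite) chart set \<Rightarrow> ('m, 'n) jet_index \<Rightarrow> 'm jet vfield" where
  "d_t A k = coord_field (jet_atlas A) (jet_chart A k) (1, 0, 0)"

definition d_x ::
  "('m, real ^ 'n::finite) chart set \<Rightarrow> ('m, 'n) jet_index \<Rightarrow> 'n \<Rightarrow> 'm jet vfield" where
  "d_x A k i = coord_field (jet_atlas A) (jet_chart A k) (0, axis i 1, 0)"

definition d_y ::
  "('m, real ^ 'n::finite) chart set \<Rightarrow> ('m, 'n) jet_index \<Rightarrow> 'n \<Rightarrow> 'm jet vfield" where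
  "d_y A k i = coord_field (jet_atlas A) (jet_chart A k) (0, 0, axis i 1)"

section \<open>Nonlinear connections and \<open>\<Gamma>\<close>-linear connections\<close>

text \<open>\<open>M k i\<close> stands for \<open>M\<^sub>(\<^sub>1\<^sub>)\<^sub>1\<^sup>(\<^sup>i\<^sup>)\<close> and \<open>N k i j\<close> for \<open>N\<^sub>(\<^sub>1\<^sub>)\<^sub>j\<^sup>(\<^sup>i\<^sup>)\<close> in the chart \<open>k\<close>;
  throughout, upper indices come first. In the transformation laws \<open>k\<close> carries the coordinates
  without and \<open>k'\<close> those with a tilde, so \<open>dt/d\<close>(tilde \<open>t\<close>) is \<open>d_t A k' z (t_coord k)\<close>.\<close>

type_synonym ('m, 'n) tconn = "('m, 'n) jet_index \<Rightarrow> 'n \<Rightarrow> 'm jet \<Rightarrow> real"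
type_synonym ('m, 'n) sconn = "('m, 'n) jet_index \<Rightarrow> 'n \<Rightarrow> 'n \<Rightarrow> 'm jet \<Rightarrow> real"

definition nonlinear_connection :: "('m, real ^ 'n::finite) chart set \<Rightarrow>
    ('m, 'n) tconn \<Rightarrow> ('m, 'n) sconn \<Rightarrow> bool" where
  "nonlinear_connection A M N \<longleftrightarrow>
     (\<forall>k\<in>jet_indices A. \<forall>z\<in>jet_dom A k. \<forall>i j.
        smooth_at (jet_atlas A) (M k i) z \<and> smooth_at (jet_atlas A) (N k i j) z) \<and>
     (\<forall>k\<in>jet_indices A. \<forall>k'\<in>jet_indices A. \<forall>z\<in>jet_dom A k \<inter> jet_dom A k'. \<forall>m l.
        M k' m z =
          (\<Sum>j\<in>UNIV. M k j z * (d_t A k' z (t_coord k))\<^sup>2 * d_x A k j z (x_coord k' m))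
          - d_t A k' z (t_coord k) * d_t A k z (y_coord k' m) \<and>
        N k' m l z =
          (\<Sum>j\<in>UNIV. \<Sum>i\<in>UNIV. N k j i z * d_t A k' z (t_coord k) *
             d_x A k' l z (x_coord k i) * d_x A k j z (x_coord k' m))
          - (\<Sum>i\<in>UNIV. d_x A k' l z (x_coord k i) * d_x A k i z (y_coord k' m)))"

definition delta_t :: "('m, real ^ 'n::finite) chart set \<Rightarrow>
    ('m, 'n) tconn \<Rightarrow> ('m, 'n) jet_index \<Rightarrow> 'm jet vfield" where
  "delta_t A M k = (\<lambda>z f. d_t A k z f - (\<Sum>j\<in>UNIV. M k j z * d_y A k j z f))"

definition delta_x :: "('m, real ^ 'n::finite) chart set \<Rightarrow>
    ('m, 'n) sconn \<Rightarrow> ('m, 'n) jet_index \<Rightarrow> 'n \<Rightarrow> 'm jet vfield" where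
  "delta_x A N k i = (\<lambda>z f. d_x A k i z f - (\<Sum>j\<in>UNIV. N k j i z * d_y A k j z f))"

text \<open>The three summands of the tangent space of \<open>E\<close> at \<open>z\<close>. By the transformation laws they do
  not depend on the chart around \<open>z\<close>.\<close>

definition HR_space :: "('m, real ^ 'n::finite) chart set \<Rightarrow>
    ('m, 'n) tconn \<Rightarrow> 'm jet \<Rightarrow> 'm jet tvec set" where
  "HR_space A M z = {(\<lambda>f. a * delta_t A M k z f) | k a. k \<in> jet_indices A \<and> z \<in> jet_dom A k}"

definition HM_space :: "('m, real ^ 'n::finite) chart set \<Rightarrow>
    ('m, 'n) sconn \<Rightarrow> 'm jet \<Rightarrow> 'm jet tvec set" where
  "HM_space A N z =
     {(\<lambda>f. \<Sum>i\<in>UNIV. b i * delta_x A N k i z f) | k b. k \<in> jet_indices A \<and> z \<in> jet_dom A k}"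

definition V_space :: "('m, real ^ 'n::finite) chart set \<Rightarrow> 'm jet \<Rightarrow> 'm jet tvec set" where
  "V_space A z =
     {(\<lambda>f. \<Sum>i\<in>UNIV. b i * d_y A k i z f) | k b. k \<in> jet_indices A \<and> z \<in> jet_dom A k}"

text \<open>The component of \<open>x\<close> in the first of three complementary spaces.\<close>

definition component :: "'a tvec set \<Rightarrow> 'a tvec set \<Rightarrow> 'a tvec set \<Rightarrow> 'a tvec \<Rightarrow> 'a tvec" where
  "component S1 S2 S3 x =
     (THE u. u \<in> S1 \<and> (\<exists>v\<in>S2. \<exists>w\<in>S3. x = (\<lambda>f. u f + v f + w f)))"

definition hR :: "('m, real ^ 'n::finite) chart set \<Rightarrow>
    ('m, 'n) tconn \<Rightarrow> ('m, 'n) sconn \<Rightarrow> 'm jet vfield \<Rightarrow> 'm jet vfield" where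
  "hR A M N X z = (if z \<in> J1 A
     then component (HR_space A M z) (HM_space A N z) (V_space A z) (X z) else (\<lambda>f. 0))"

definition hM :: "('m, real ^ 'n::finite) chart set \<Rightarrow>
    ('m, 'n) tconn \<Rightarrow> ('m, 'n) sconn \<Rightarrow> 'm jet vfield \<Rightarrow> 'm jet vfield" where
  "hM A M N X z = (if z \<in> J1 A
     then component (HM_space A N z) (HR_space A M z) (V_space A z) (X z) else (\<lambda>f. 0))"

definition vproj :: "('m, real ^ 'n::finite) chart set \<Rightarrow>
    ('m, 'n) tconn \<Rightarrow> ('m, 'n) sconn \<Rightarrow> 'm jet vfield \<Rightarrow> 'm jet vfield" where
  "vproj A M N X z = (if z \<in> J1 A
     then component (V_space A z) (HR_space A M z) (HM_space A N z) (X z) else (\<lambda>f. 0))"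

definition Gamma_linear_connection :: "('m, real ^ 'n::finite) chart set \<Rightarrow>
    ('m, 'n) tconn \<Rightarrow> ('m, 'n) sconn \<Rightarrow>
    ('m jet vfield \<Rightarrow> 'm jet vfield \<Rightarrow> 'm jet vfield) \<Rightarrow> bool" where
  "Gamma_linear_connection A M N nabla \<longleftrightarrow>
     linear_connection (jet_atlas A) nabla \<and>
     (\<forall>h\<in>{hR A M N, hM A M N, vproj A M N}. \<forall>X Y.
        vector_field (jet_atlas A) X \<and> vector_field (jet_atlas A) Y \<longrightarrow>
        nabla X (h Y) = h (nabla X Y))"

text \<open>In \<open>Gv m i\<close>, \<open>Lv m i j\<close> and \<open>Cv m i j\<close> (the coefficients with bracketed indices, for
  the derivatives of \<open>d_y A k i\<close>) and likewise in the others, \<open>m\<close> is the upper index and \<open>j\<close> the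
  direction of differentiation.\<close>

definition adapted_coefficients :: "('m, real ^ 'n::finite) chart set \<Rightarrow>
    ('m, 'n) tconn \<Rightarrow> ('m, 'n) sconn \<Rightarrow>
    ('m jet vfield \<Rightarrow> 'm jet vfield \<Rightarrow> 'm jet vfield) \<Rightarrow> ('m, 'n) jet_index \<Rightarrow>
    ('m jet \<Rightarrow> real) \<Rightarrow> ('n \<Rightarrow> 'n \<Rightarrow> 'm jet \<Rightarrow> real) \<Rightarrow> ('n \<Rightarrow> 'n \<Rightarrow> 'm jet \<Rightarrow> real) \<Rightarrow>
    ('n \<Rightarrow> 'm jet \<Rightarrow> real) \<Rightarrow> ('n \<Rightarrow> 'n \<Rightarrow> 'n \<Rightarrow> 'm jet \<Rightarrow> real) \<Rightarrow>
      ('n \<Rightarrow> 'n \<Rightarrow> 'n \<Rightarrow> 'm jet \<Rightarrow> real) \<Rightarrow>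
    ('n \<Rightarrow> 'm jet \<Rightarrow> real) \<Rightarrow> ('n \<Rightarrow> 'n \<Rightarrow> 'n \<Rightarrow> 'm jet \<Rightarrow> real) \<Rightarrow>
      ('n \<Rightarrow> 'n \<Rightarrow> 'n \<Rightarrow> 'm jet \<Rightarrow> real) \<Rightarrow> bool" where
  "adapted_coefficients A M N nabla k Gbar G Gv Lbar L Lv Cbar C Cv \<longleftrightarrow>
    (let D = local_nabla (jet_atlas A) nabla;
         et = delta_t A M k; ex = delta_x A N k; ey = d_y A k in
     \<forall>z\<in>jet_dom A k. \<forall>i j.
       D et et z = (\<lambda>f. Gbar z * et z f) \<and>
       D et (ex i) z = (\<lambda>f. \<Sum>m\<in>UNIV. G m i z * ex m z f) \<and>
       D et (ey i) z = (\<lambda>f. \<Sum>m\<in>UNIV. Gv m i z * ey m z f) \<and>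
       D (ex j) et z = (\<lambda>f. Lbar j z * et z f) \<and>
       D (ex j) (ex i) z = (\<lambda>f. \<Sum>m\<in>UNIV. L m i j z * ex m z f) \<and>
       D (ex j) (ey i) z = (\<lambda>f. \<Sum>m\<in>UNIV. Lv m i j z * ey m z f) \<and>
       D (ey j) et z = (\<lambda>f. Cbar j z * et z f) \<and>
       D (ey j) (ex i) z = (\<lambda>f. \<Sum>m\<in>UNIV. C m i j z * ex m z f) \<and>
       D (ey j) (ey i) z = (\<lambda>f. \<Sum>m\<in>UNIV. Cv m i j z * ey m z f))"

section \<open>Covariant derivatives and deflection tensors\<close>

definition cov_t :: "('m, real ^ 'n::finite) chart set \<Rightarrow> ('m, 'n) tconn \<Rightarrow>
    ('m, 'n) jet_index \<Rightarrow> ('n \<Rightarrow> 'n \<Rightarrow> 'm jet \<Rightarrow> real) \<Rightarrow>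
    ('n \<Rightarrow> 'm jet \<Rightarrow> real) \<Rightarrow> 'n \<Rightarrow> 'm jet \<Rightarrow> real" where
  "cov_t A M k Gv Y i z = delta_t A M k z (Y i) + (\<Sum>r\<in>UNIV. Y r z * Gv i r z)"

definition cov_x :: "('m, real ^ 'n::finite) chart set \<Rightarrow> ('m, 'n) sconn \<Rightarrow>
    ('m, 'n) jet_index \<Rightarrow> ('n \<Rightarrow> 'n \<Rightarrow> 'n \<Rightarrow> 'm jet \<Rightarrow> real) \<Rightarrow>
    ('n \<Rightarrow> 'm jet \<Rightarrow> real) \<Rightarrow> 'n \<Rightarrow> 'n \<Rightarrow> 'm jet \<Rightarrow> real" where
  "cov_x A N k Lv Y i p z = delta_x A N k p z (Y i) + (\<Sum>r\<in>UNIV. Y r z * Lv i r p z)"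

definition cov_y :: "('m, real ^ 'n::finite) chart set \<Rightarrow>
    ('m, 'n) jet_index \<Rightarrow> ('n \<Rightarrow> 'n \<Rightarrow> 'n \<Rightarrow> 'm jet \<Rightarrow> real) \<Rightarrow>
    ('n \<Rightarrow> 'm jet \<Rightarrow> real) \<Rightarrow> 'n \<Rightarrow> 'n \<Rightarrow> 'm jet \<Rightarrow> real" where
  "cov_y A k Cv Y i p z = d_y A k p z (Y i) + (\<Sum>r\<in>UNIV. Y r z * Cv i r p z)"

definition liouville :: "('m, 'n::finite) jet_index \<Rightarrow> 'n \<Rightarrow> 'm jet \<Rightarrow> real" where
  "liouville k i = y_coord k i"

definition deflection_t :: "('m, real ^ 'n::finite) chart set \<Rightarrow> ('m, 'n) tconn \<Rightarrow>
    ('m, 'n) jet_index \<Rightarrow> ('n \<Rightarrow> 'n \<Rightarrow> 'm jet \<Rightarrow> real) \<Rightarrow> 'n \<Rightarrow> 'm jet \<Rightarrow> real" where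
  "deflection_t A M k Gv = cov_t A M k Gv (liouville k)"

definition deflection_x :: "('m, real ^ 'n::finite) chart set \<Rightarrow> ('m, 'n) sconn \<Rightarrow>
    ('m, 'n) jet_index \<Rightarrow> ('n \<Rightarrow> 'n \<Rightarrow> 'n \<Rightarrow> 'm jet \<Rightarrow> real) \<Rightarrow>
    'n \<Rightarrow> 'n \<Rightarrow> 'm jet \<Rightarrow> real" where
  "deflection_x A N k Lv = cov_x A N k Lv (liouville k)"

definition deflection_y :: "('m, real ^ 'n::finite) chart set \<Rightarrow>
    ('m, 'n) jet_index \<Rightarrow> ('n \<Rightarrow> 'n \<Rightarrow> 'n \<Rightarrow> 'm jet \<Rightarrow> real) \<Rightarrow>
    'n \<Rightarrow> 'n \<Rightarrow> 'm jet \<Rightarrow> real" where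
  "deflection_y A k Cv = cov_y A k Cv (liouville k)"

end

theory Submission
  imports Defs
begin

text \<open>
  Each deflection tensor is a covariant derivative of the functions \<open>y\<^sup>i\<close>, so only the
  derivatives of \<open>y\<^sup>i\<close> along the adapted frame are at stake. In the chart of \<open>E\<close> the function
  \<open>y\<^sup>i\<close> is a coordinate, hence its derivatives along \<open>t\<close> and \<open>x\<^sup>j\<close> vanish and the one along
  \<open>y\<^sup>j\<close> is the Kronecker delta; in \<open>\<delta>/\<delta>t\<close> and \<open>\<delta>/\<delta>x\<^sup>j\<close> only the vertical parts, with
  coefficients \<open>-M\<close> and \<open>-N\<close>, contribute.

  The point that requires proof is that a coordinate function may be differentiated at all: the
  coordinate values near those of a given jet must again belong to jets, so that \<open>y\<^sup>i\<close>, read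
  in the chart, is a linear projection on a whole neighbourhood. This is \<open>jet_chart_image\<close>: over \<open>\<phi>(T)\<close> and \<open>\<psi>(U)\<close>, the images of the time chart and of the chart
  of \<open>M\<close>, every velocity \<open>v\<close> is attained, namely by the jet of a curve that is a straight line
  in the chart of \<open>M\<close>.
\<close>

text \<open>The derivative of an affine map in a fixed direction is constant, hence affine again; this
  makes the induction on the order of differentiability go through.\<close>

lemma smooth_on_affine:
  assumes "open S" "bounded_linear h" "\<And>x. x \<in> S \<Longrightarrow> f x = a + h x"
  shows "smooth_on S f"
proof -
  have "C_diff_on n S f" for n
    using assms(2,3)
  proof (induction n arbitrary: f a h)
    case 0
    have "continuous_on S (\<lambda>x. a + h x)"
      by (intro continuous_intros linear_continuous_on 0)
    then show ?case
      using 0(2) by (simp cong: continuous_on_cong)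
  next
    case (Suc n)
    have der: "(f has_derivative h) (at x)" if "x \<in> S" for x
    proof -
      have "((\<lambda>x. a + h x) has_derivative h) (at x)"
        using has_derivative_add[OF has_derivative_const bounded_linear_imp_has_derivative[OF Suc(2)]]
        by simp
      then show ?thesis
        by (rule has_derivative_transform_within_open[OF _ assms(1) that]) (simp add: Suc(3))
    qed
    have fd: "frechet_derivative f (at x) v = h v + 0" if "x \<in> S" for x v
      using frechet_derivative_at[OF der[OF that]] by simp
    have "C_diff_on n S (\<lambda>x. frechet_derivative f (at x) v)" for v
      by (rule Suc.IH[OF bounded_linear_zero]) (rule fd)
    then show ?case
      using der by (auto simp: differentiable_def)
  qed
  then show ?thesis
    by (simp add: smooth_on_def)
qed

lemma smooth_on_imp_differentiable:
  assumes "smooth_on S f" "x \<in> S"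
  shows "f differentiable (at x)"
proof -
  have "C_diff_on (Suc 0) S f"
    using assms(1) by (simp add: smooth_on_def)
  then show ?thesis
    using assms(2) by simp
qed

lemma is_chart_inj_on:
  assumes "is_chart X c"
  shows "inj_on (cmap c) (cdom c)"
proof -
  have "topspace (subtopology X (cdom c)) = cdom c"
    using assms openin_subset by (fastforce simp: is_chart_def)
  then show ?thesis
    using assms homeomorphic_imp_injective_map unfolding is_chart_def by metis
qed

lemma cinv_cmap:
  assumes "is_chart X c" "p \<in> cdom c"
  shows "cinv c (cmap c p) = p"
  unfolding cinv_def using inv_into_f_f[OF is_chart_inj_on[OF assms(1)] assms(2)] .

lemma cmap_cinv:
  assumes "u \<in> cmap c ` cdom c"
  shows "cmap c (cinv c u) = u" "cinv c u \<in> cdom c"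
  unfolding cinv_def using f_inv_into_f[OF assms] inv_into_into[OF assms] by auto

text \<open>Smoothness of a curve is witnessed by a single chart; by compatibility, it can be
  differentiated in every chart.\<close>

lemma smooth_curve_at_differentiable:
  assumes A: "smooth_manifold X A" and c: "c \<in> A"
    and \<eta>: "smooth_curve_at A \<eta> t" "\<eta> t \<in> cdom c"
  shows "(cmap c \<circ> \<eta>) differentiable (at t)"
proof -
  obtain d J where d: "d \<in> A" and J: "open J" "t \<in> J" "\<eta> ` J \<subseteq> cdom d"
    and sm: "smooth_on J (cmap d \<circ> \<eta>)"
    using \<eta>(1) by (auto simp: smooth_curve_at_def)
  have "compatible d c" and d_chart: "is_chart X d"
    using A c d by (auto simp: smooth_manifold_def)
  then have trans: "(cmap c \<circ> cinv d) differentiable (at ((cmap d \<circ> \<eta>) t))"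
    using J \<eta>(2) by (intro smooth_on_imp_differentiable) (auto simp: compatible_def)
  have "((cmap c \<circ> cinv d) \<circ> (cmap d \<circ> \<eta>)) differentiable (at t)"
    by (rule differentiable_chain_at[OF smooth_on_imp_differentiable[OF sm J(2)] trans])
  then obtain D where D: "((cmap c \<circ> cinv d) \<circ> (cmap d \<circ> \<eta>) has_derivative D) (at t)"
    by (auto simp: differentiable_def)
  have "(cmap c \<circ> \<eta> has_derivative D) (at t)"
  proof (rule has_derivative_transform_within_open[OF D J(1,2)])
    fix s assume "s \<in> J"
    then have "\<eta> s \<in> cdom d"
      using J(3) by auto
    then show "((cmap c \<circ> cinv d) \<circ> (cmap d \<circ> \<eta>)) s = (cmap c \<circ> \<eta>) s"
      by (simp add: cinv_cmap[OF d_chart])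
  qed
  then show ?thesis
    by (auto simp: differentiable_def)
qed

text \<open>A time chart and its inverse are both smooth as real functions, so the chain rule makes
  their derivatives reciprocal.\<close>

lemma time_chart_derivatives:
  assumes b: "b \<in> time_atlas" and t: "t \<in> cdom b"
  obtains p q where "(cinv b has_vector_derivative q) (at (cmap b t))" "q * p = 1"
proof -
  have chart: "is_chart euclidean b" and comp: "compatible b (UNIV, id)"
    using b by (auto simp: time_atlas_def)
  have id_inv: "cinv (UNIV, id :: real \<Rightarrow> real) = id"
    by (simp add: cinv_def)
  have "cmap b differentiable (at t)"
    using comp t by (intro smooth_on_imp_differentiable) (auto simp: compatible_def id_inv)
  then obtain p where p: "(cmap b has_vector_derivative p) (at t)"
    using vector_derivative_works by blast
  have "cinv b differentiable (at (cmap b t))"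
    using comp t by (intro smooth_on_imp_differentiable) (auto simp: compatible_def)
  then obtain q where q: "(cinv b has_vector_derivative q) (at (cmap b t))"
    using vector_derivative_works by blast
  have "(cinv b \<circ> cmap b has_vector_derivative p *\<^sub>R q) (at t)"
    by (rule vector_diff_chain_at[OF p q])
  moreover have "(cinv b \<circ> cmap b has_vector_derivative 1) (at t)"
  proof (rule has_vector_derivative_transform_within_open[OF has_vector_derivative_id])
    show "open (cdom b)"
      using chart by (simp add: is_chart_def)
  qed (use t in \<open>auto simp: cinv_cmap[OF chart]\<close>)
  ultimately have "p *\<^sub>R q = 1"
    by (rule vector_derivative_unique_at)
  then have "q * p = 1"
    by (simp add: mult.commute)
  with q show thesis
    by (rule that)
qed

lemma jet_of_representative:
  assumes "smooth_curve_at A \<gamma> t"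
  shows "jet_time (jet_of A t \<gamma>) = t"
    and "(t, jet_curve (jet_of A t \<gamma>)) \<in> jet_of A t \<gamma>"
proof -
  have "(t, \<gamma>) \<in> jet_of A t \<gamma>"
    using assms by (auto simp: jet_of_def)
  then have some: "(SOME r. r \<in> jet_of A t \<gamma>) \<in> jet_of A t \<gamma>"
    by (rule someI)
  then show time: "jet_time (jet_of A t \<gamma>) = t"
    by (auto simp: jet_time_def jet_of_def)
  have "(SOME r. r \<in> jet_of A t \<gamma>) = (t, jet_curve (jet_of A t \<gamma>))"
    using time by (simp add: jet_time_def jet_curve_def prod_eq_iff)
  with some show "(t, jet_curve (jet_of A t \<gamma>)) \<in> jet_of A t \<gamma>"
    by simp
qed

text \<open>The velocity \<open>v\<close> is taken with respect to the chart \<open>\<phi>\<close> of the time line, while a jet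
  records derivatives with respect to the standard time. The jet with coordinates \<open>(\<tau>, u, v)\<close>,
  \<open>\<tau> = \<phi>(t)\<close>, is therefore that of the curve whose image in the chart of \<open>M\<close> is the line
  through \<open>u\<close> at time \<open>t\<close> with velocity \<open>\<phi>'(t) v\<close>.\<close>

lemma jet_chart_image:
  fixes A :: "('m, real ^ 'n::finite) chart set"
  assumes A: "smooth_manifold X A" and k: "k \<in> jet_indices A"
  shows "(cmap (fst k) ` cdom (fst k)) \<times> (cmap (snd k) ` cdom (snd k)) \<times> UNIV
    \<subseteq> cmap (jet_chart A k) ` cdom (jet_chart A k)"
proof (clarify)
  obtain b c where k_eq: "k = (b, c)"
    by (cases k)
  have b: "b \<in> time_atlas" and c: "c \<in> A"
    using k by (auto simp: k_eq jet_indices_def)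
  have b_chart: "is_chart euclidean b" and c_chart: "is_chart X c"
    using A b c by (auto simp: time_atlas_def smooth_manifold_def)
  fix t x and v :: "real ^ 'n"
  assume "t \<in> cdom (fst k)" "x \<in> cdom (snd k)"
  then have t: "t \<in> cdom b" and x: "x \<in> cdom c"
    by (simp_all add: k_eq)
  obtain p q where q: "(cinv b has_vector_derivative q) (at (cmap b t))" and qp: "q * p = 1"
    using time_chart_derivatives[OF b t] .
  let ?l = "\<lambda>s. cmap c x + (s - t) *\<^sub>R (p *\<^sub>R v)"
  define \<gamma> where "\<gamma> = (\<lambda>s. cinv c (?l s))"
  define J where "J = ?l -` (cmap c ` cdom c)"
  have "open J"
    unfolding J_def using c_chart
    by (intro open_vimage continuous_intros) (simp add: is_chart_def)
  have "t \<in> J"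
    using x by (simp add: J_def)
  have line: "cmap c (\<gamma> s) = ?l s" "\<gamma> s \<in> cdom c" if "s \<in> J" for s
    using that by (simp_all add: J_def \<gamma>_def cmap_cinv)
  have "smooth_on J (cmap c \<circ> \<gamma>)"
  proof (rule smooth_on_affine[OF \<open>open J\<close> bounded_linear_scaleR_left])
    fix s assume "s \<in> J"
    then show "(cmap c \<circ> \<gamma>) s = (cmap c x - t *\<^sub>R (p *\<^sub>R v)) + s *\<^sub>R (p *\<^sub>R v)"
      by (simp add: line algebra_simps)
  qed
  then have \<gamma>: "smooth_curve_at A \<gamma> t"
    unfolding smooth_curve_at_def using c \<open>open J\<close> \<open>t \<in> J\<close> line(2) by blast
  have \<gamma>_t: "\<gamma> t = x"
    using cinv_cmap[OF c_chart x] by (simp add: \<gamma>_def)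
  have "(?l has_vector_derivative p *\<^sub>R v) (at t)"
    by (auto intro!: derivative_eq_intros)
  then have "(cmap c \<circ> \<gamma> has_vector_derivative p *\<^sub>R v) (at t)"
    by (rule has_vector_derivative_transform_within_open[OF _ \<open>open J\<close> \<open>t \<in> J\<close>]) (simp add: line)
  then have \<gamma>': "vector_derivative (cmap c \<circ> \<gamma>) (at t) = p *\<^sub>R v"
    by (rule vector_derivative_at)
  define z where "z = jet_of A t \<gamma>"
  \<comment> \<open>The coordinates of \<open>z\<close> are read off an arbitrary representative, which need not be \<open>\<gamma>\<close>.\<close>
  define \<eta> where "\<eta> = jet_curve z"
  have time: "jet_time z = t"
    using jet_of_representative(1)[OF \<gamma>] by (simp add: z_def)
  have "(t, \<eta>) \<in> jet_of A t \<gamma>"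
    using jet_of_representative(2)[OF \<gamma>] by (simp add: z_def \<eta>_def)
  then have \<eta>: "smooth_curve_at A \<eta> t" and \<eta>_t: "\<eta> t = x"
    and \<eta>': "vector_derivative (cmap c \<circ> \<eta>) (at t) = p *\<^sub>R v"
    using c x by (auto simp: jet_of_def \<gamma>_t \<gamma>')
  have point: "jet_point z = x"
    using time \<eta>_t by (simp add: jet_point_def \<eta>_def)
  have "(cmap c \<circ> \<eta> has_vector_derivative p *\<^sub>R v) (at t)"
    using smooth_curve_at_differentiable[OF A c \<eta>] \<eta>_t x \<eta>' vector_derivative_works by metis
  then have "(cmap c \<circ> \<eta> has_vector_derivative p *\<^sub>R v) (at (cinv b (cmap b t)))"
    by (simp add: cinv_cmap[OF b_chart t])
  then have "(cmap c \<circ> \<eta> \<circ> cinv b has_vector_derivative q *\<^sub>R (p *\<^sub>R v)) (at (cmap b t))"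
    by (rule vector_diff_chain_at[OF q])
  then have "vector_derivative (cmap c \<circ> \<eta> \<circ> cinv b) (at (cmap b t)) = v"
    by (simp add: vector_derivative_at qp)
  then have coords: "cmap (jet_chart A k) z = (cmap b t, cmap c x, v)"
    by (simp add: jet_chart_def t_coord_def x_coord_def y_coord_def k_eq time point \<eta>_def)
  have "z \<in> J1 A"
    using \<gamma> by (auto simp: J1_def z_def)
  then have "z \<in> cdom (jet_chart A k)"
    using t x by (simp add: jet_chart_def jet_dom_def k_eq time point)
  with coords show "(cmap (fst k) t, cmap (snd k) x, v) \<in>
      cmap (jet_chart A k) ` cdom (jet_chart A k)"
    unfolding k_eq by (metis fst_conv snd_conv image_eqI)
qed

text \<open>As \<open>y\<^sup>i\<close> is a component of the chart, its coordinate expression is a linear projection on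
  the image of the chart, and the coordinate fields act on it as on that projection.\<close>

lemma coord_field_y_coord:
  fixes A :: "('m, real ^ 'n::finite) chart set"
  assumes A: "smooth_manifold X A" and k: "k \<in> jet_indices A" and z: "z \<in> jet_dom A k"
  shows "coord_field (jet_atlas A) (jet_chart A k) w z (y_coord k i) = snd (snd w) $ i"
proof -
  define W where "W = (cmap (fst k) ` cdom (fst k)) \<times> (cmap (snd k) ` cdom (snd k)) \<times>
    (UNIV :: (real ^ 'n) set)"
  let ?c = "jet_chart A k"
  let ?pr = "\<lambda>w :: real \<times> (real ^ 'n) \<times> (real ^ 'n). snd (snd w) $ i"
  have "is_chart euclidean (fst k)" "is_chart X (snd k)"
    using A k by (auto simp: jet_indices_def time_atlas_def smooth_manifold_def)
  then have "open W"
    unfolding W_def by (intro open_Times open_UNIV) (simp_all add: is_chart_def)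
  have sub: "W \<subseteq> cmap ?c ` cdom ?c"
    unfolding W_def by (rule jet_chart_image[OF A k])
  have zW: "cmap ?c z \<in> W"
    using z by (auto simp: W_def jet_chart_def jet_dom_def t_coord_def x_coord_def)
  have pr: "bounded_linear ?pr"
    by (intro bounded_linear_compose[OF bounded_linear_vec_nth]
        bounded_linear_compose[OF bounded_linear_snd] bounded_linear_snd)
  have proj: "(y_coord k i \<circ> cinv ?c) u = ?pr u" if "u \<in> W" for u
  proof -
    have "cmap ?c (cinv ?c u) = u"
      using that sub by (intro cmap_cinv(1)) blast
    moreover have "snd (snd (cmap ?c q)) $ i = y_coord k i q" for q
      by (simp add: jet_chart_def)
    ultimately show ?thesis
      by (metis comp_apply)
  qed
  have "smooth_on W (y_coord k i \<circ> cinv ?c)"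
    by (rule smooth_on_affine[OF \<open>open W\<close> pr, where a = 0]) (simp add: proj[unfolded comp_def])
  moreover have "?c \<in> jet_atlas A" "z \<in> cdom ?c"
    using k z by (auto simp: jet_atlas_def jet_chart_def)
  ultimately have "smooth_at (jet_atlas A) (y_coord k i) z"
    unfolding smooth_at_def using \<open>open W\<close> zW sub by blast
  moreover have "(y_coord k i \<circ> cinv ?c has_derivative ?pr) (at (cmap ?c z))"
    by (rule has_derivative_transform_within_open
        [OF bounded_linear_imp_has_derivative[OF pr] \<open>open W\<close> zW]) (rule proj[symmetric])
  ultimately show ?thesis
    by (simp add: coord_field_def frechet_derivative_at[symmetric])
qed

lemma frame_y_coord:
  fixes A :: "('m, real ^ 'n::finite) chart set"
  assumes "smooth_manifold X A" "k \<in> jet_indices A" "z \<in> jet_dom A k"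
  shows "d_t A k z (y_coord k i) = 0"
    and "d_x A k j z (y_coord k i) = 0"
    and "d_y A k j z (y_coord k i) = (if i = j then 1 else 0)"
    and "delta_t A M k z (y_coord k i) = - M k i z"
    and "delta_x A N k j z (y_coord k i) = - N k i j z"
proof -
  show t: "d_t A k z (y_coord k i) = 0"
    and x: "d_x A k j z (y_coord k i) = 0" for j
    by (simp_all add: d_t_def d_x_def coord_field_y_coord[OF assms])
  show y: "d_y A k j z (y_coord k i) = (if i = j then 1 else 0)" for j
    by (simp add: d_y_def coord_field_y_coord[OF assms] axis_def)
  show "delta_t A M k z (y_coord k i) = - M k i z"
    and "delta_x A N k j z (y_coord k i) = - N k i j z"
    by (simp_all add: delta_t_def delta_x_def t x y if_distrib[of "(*) _"] cong: if_cong)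
qed

theorem proposition4p3:
  fixes X :: "'m topology"
    and A :: "('m, real ^ 'n::finite) chart set"
    and M :: "('m, 'n) tconn"
    and N :: "('m, 'n) sconn"
    and nabla :: "'m jet vfield \<Rightarrow> 'm jet vfield \<Rightarrow> 'm jet vfield"
    and k :: "('m, 'n) jet_index"
    and Gbar :: "'m jet \<Rightarrow> real"
    and G Gv :: "'n \<Rightarrow> 'n \<Rightarrow> 'm jet \<Rightarrow> real"
    and Lbar Cbar :: "'n \<Rightarrow> 'm jet \<Rightarrow> real"
    and L Lv C Cv :: "'n \<Rightarrow> 'n \<Rightarrow> 'n \<Rightarrow> 'm jet \<Rightarrow> real"
  assumes "smooth_manifold X A"
    and "nonlinear_connection A M N"
    and "Gamma_linear_connection A M N nabla"
    and "k \<in> jet_indices A"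
    and "adapted_coefficients A M N nabla k Gbar G Gv Lbar L Lv Cbar C Cv"
  shows "\<forall>z\<in>jet_dom A k. \<forall>i j.
      deflection_t A M k Gv i z = - M k i z + (\<Sum>r\<in>UNIV. Gv i r z * y_coord k r z) \<and>
      deflection_x A N k Lv i j z = - N k i j z + (\<Sum>r\<in>UNIV. Lv i r j z * y_coord k r z) \<and>
      deflection_y A k Cv i j z =
        (if i = j then 1 else 0) + (\<Sum>r\<in>UNIV. Cv i r j z * y_coord k r z)"
  using assms(1,4)
  by (simp add: deflection_t_def deflection_x_def deflection_y_def cov_t_def cov_x_def cov_y_def
      liouville_def frame_y_coord mult.commute)

end
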